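(* Let $t\geq 3$ and $m\geq 2$ be integers. Then for every integer $c$ with $mt+1\leq c\leq mt^2+2$ and $c\neq mt+2$, there exists a quantum Latin square of order $mt+1$ with cardinality $c$.
   Context: A quantum Latin square of order $v$, QLS$(v)$, is a $v\times v$ array $\Phi=(|\Phi_{i,j}\rangle)$ whose entries are unit column vectors of $\mathbb{C}^v$ such that the entries of every row form an orthonormal basis of $\mathbb{C}^v$ and the entries of every column form an orthonormal basis of $\mathbb{C}^v$. Two unit vectors $|u\rangle,|w\rangle\in\mathbb{C}^v$ have the same global phase if $|u\rangle=e^{\mathrm{i}\theta}|w\rangle$ for some $\theta\in[0,2\pi)$; otherwise they are distinct (up to a global phase). The cardinality of a QLS$(v)$ is the number of its entries that are distinct up to a global phase, i.e. the number of classes of its $v^2$ entries under the relation "same global phase". *)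

theory Defs
  imports "HOL-Analysis.Analysis" "Jordan_Normal_Form.VS_Connect"
begin

text \<open>
  A finite family of vectors is a list, so that repeated vectors are visible: orthonormality is
  required of the positions in the list and not merely of the set of its elements.
\<close>

definition orthonormal_basis :: "nat \<Rightarrow> complex vec list \<Rightarrow> bool" where
  "orthonormal_basis v us \<longleftrightarrow>
     set us \<subseteq> carrier_vec v \<and>
     (\<forall>i < length us. \<forall>j < length us. us ! i \<bullet>c us ! j = (if i = j then 1 else 0)) \<and>
     vectorspace.basis class_ring (module_vec TYPE(complex) v) (set us)"

definition quantum_latin_square :: "nat \<Rightarrow> complex vec mat \<Rightarrow> bool" where
  "quantum_latin_square v \<Phi> \<longleftrightarrow>
     \<Phi> \<in> carrier_mat v v \<and>
     (\<forall>i < v. orthonormal_basis v (list_of_vec (row \<Phi> i))) \<and>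
     (\<forall>j < v. orthonormal_basis v (list_of_vec (col \<Phi> j)))"

definition same_global_phase :: "complex vec \<Rightarrow> complex vec \<Rightarrow> bool" where
  "same_global_phase u w \<longleftrightarrow> (\<exists>\<theta> \<in> {0..<2 * pi}. u = cis \<theta> \<cdot>\<^sub>v w)"

definition phase_rel :: "complex vec set \<Rightarrow> (complex vec \<times> complex vec) set" where
  "phase_rel E = {(u, w). u \<in> E \<and> w \<in> E \<and> same_global_phase u w}"

definition qls_cardinality :: "complex vec mat \<Rightarrow> nat" where
  "qls_cardinality \<Phi> = card (elements_mat \<Phi> // phase_rel (elements_mat \<Phi>))"

lemma same_global_phase_iff: "same_global_phase u w \<longleftrightarrow> (\<exists>\<theta>. u = cis \<theta> \<cdot>\<^sub>v w)"
proof
  assume "\<exists>\<theta>. u = cis \<theta> \<cdot>\<^sub>v w"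
  then obtain \<theta> where u: "u = cis \<theta> \<cdot>\<^sub>v w" by blast
  have "cis (Arg2pi (cis \<theta>)) = cis \<theta>"
    using Arg2pi_eq[of "cis \<theta>"] by (simp add: cis_conv_exp)
  moreover have "Arg2pi (cis \<theta>) \<in> {0..<2 * pi}"
    using Arg2pi_ge_0 Arg2pi_lt_2pi by simp
  ultimately show "same_global_phase u w"
    unfolding same_global_phase_def u by metis
qed (auto simp: same_global_phase_def)

lemma equiv_phase_rel: "equiv E (phase_rel E)"
proof (rule equivI)
  show "refl_on E (phase_rel E)"
    unfolding refl_on_def phase_rel_def same_global_phase_iff
    by (auto intro!: exI[of _ 0] simp: cis_zero)
  show "sym (phase_rel E)"
    unfolding sym_def phase_rel_def same_global_phase_iff
  proof clarsimp
    fix \<theta> w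
    show "\<exists>\<phi>. w = cis \<phi> \<cdot>\<^sub>v (cis \<theta> \<cdot>\<^sub>v w)"
      by (rule exI[of _ "- \<theta>"]) (simp add: smult_smult_assoc cis_mult)
  qed
  show "trans (phase_rel E)"
    unfolding trans_def phase_rel_def same_global_phase_iff
    by (auto simp: smult_smult_assoc cis_mult)
qed (auto simp: phase_rel_def)

end

theory Submission
  imports Defs
begin

text \<open>
  Blow up an idempotent Latin square of order \<open>t\<close> by \<open>m\<close> and add one point: off-diagonal blocks are
  Latin squares of order \<open>m\<close>, and each diagonal block together with the new point is a Latin square
  of order \<open>m + 1\<close>, all of these sharing the corner cell.  Replacing the symbols by basis vectors
  gives cardinality \<open>mt + 1\<close>.  In every off-diagonal block, and in one diagonal block including the
  corner, a set of symbols of any size other than 1 may be rotated by a unitary of its span; this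
  adds that many new vectors.  One off-diagonal block is left alone, so that no basis vector
  disappears; hence the cardinality can be raised by any \<open>x \<noteq> 1\<close> up to \<open>mt(t - 1) + 1\<close>.
\<close>

unbundle no vec_syntax

section \<open>Orthonormal bases from pairwise inner products\<close>

text \<open>The inner product conditions say that the matrix with rows \<open>us\<close> times its
  conjugate transpose is the identity. So its determinant is nonzero, its rows are independent, and
  \<open>v\<close> independent vectors in dimension \<open>v\<close> form a basis.\<close>

lemma orthonormal_basisI:
  assumes len: "length us = v" and car: "set us \<subseteq> carrier_vec v"
    and orth: "\<And>i j. i < v \<Longrightarrow> j < v \<Longrightarrow> us ! i \<bullet>c us ! j = (if i = j then 1 else 0)"
  shows "orthonormal_basis v us"
proof -
  interpret vec_space "TYPE(complex)" v .
  define A where "A = mat_of_rows v us"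
  define B where "B = mat_of_cols v (map conjugate us)"
  have A: "A \<in> carrier_mat v v" and B: "B \<in> carrier_mat v v"
    using len by (auto simp: A_def B_def)
  have rows: "rows A = us"
    using car by (simp add: A_def)
  have car': "us ! i \<in> carrier_vec v" if "i < v" for i
    using car len that by auto
  have "A * B = 1\<^sub>m v"
  proof (rule eq_matI)
    fix i j assume ij: "i < dim_row (1\<^sub>m v :: complex mat)" "j < dim_col (1\<^sub>m v :: complex mat)"
    then have "row A i = us ! i" "col B j = conjugate (us ! j)"
      using car' len by (auto simp: A_def B_def)
    then show "(A * B) $$ (i, j) = 1\<^sub>m v $$ (i, j)"
      using ij A B orth[of i j] by simp
  qed (use A B in auto)
  then have "det A * det B = 1"
    using det_mult[OF A B] by simp
  then have det: "det A \<noteq> 0" by auto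
  have li: "lin_indpt (set us)"
    using det_not_0_imp_lin_indpt_rows[OF A det] rows by simp
  \<comment> \<open>Equal vectors at different positions would have inner product both 0 and 1.
    Distinctness gives \<open>set us\<close> exactly \<open>v\<close> elements, as the dimension
    argument needs.\<close>
  have "distinct us"
    unfolding distinct_conv_nth
  proof (intro allI impI)
    fix i j assume "i < length us" "j < length us" "i \<noteq> j"
    then show "us ! i \<noteq> us ! j"
      using orth[of i j] orth[of i i] len by auto
  qed
  then have "basis (set us)"
    using li car len by (intro dim_li_is_basis) (auto simp: distinct_card dim_is_n)
  then show ?thesis
    unfolding orthonormal_basis_def using car orth len by auto
qed

section \<open>Perturbed basis vectors: inner products and phases\<close>

text \<open>For \<open>s \<in> K\<close> this is column \<open>s\<close> of the identity plus
  \<alpha> times the all-one matrix on \<open>K\<close>. Taking \<open>K = {}\<close> and \<alpha> =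
  0 gives the plain basis vector, so rotated and unrotated entries share one form.\<close>

definition bump :: "nat \<Rightarrow> nat set \<Rightarrow> complex \<Rightarrow> nat \<Rightarrow> complex vec" where
  "bump v K \<alpha> s = vec v (\<lambda>l. of_bool (l = s) + \<alpha> * of_bool (l \<in> K))"

lemma bump_carrier [simp]: "bump v K \<alpha> s \<in> carrier_vec v"
  by (simp add: bump_def)

lemma bump_index: "l < v \<Longrightarrow> bump v K \<alpha> s $ l = of_bool (l = s) + \<alpha> * of_bool (l \<in> K)"
  by (simp add: bump_def)

lemma bump_inner:
  assumes s: "s < v" "s' < v" and K: "K \<subseteq> {..<v}" "K' \<subseteq> {..<v}"
  shows "bump v K \<alpha> s \<bullet>c bump v K' \<alpha>' s' =
    of_bool (s = s') + cnj \<alpha>' * of_bool (s \<in> K') + \<alpha> * of_bool (s' \<in> K)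
      + \<alpha> * cnj \<alpha>' * of_nat (card (K \<inter> K'))"
proof -
  have delta: "(\<Sum>l<v. of_bool (l = r) * c) = c" if "r < v" for r and c :: complex
  proof -
    have "(\<Sum>l<v. of_bool (l = r) * c) = (\<Sum>l<v. if l = r then c else 0)"
      by (intro sum.cong) auto
    then show ?thesis using that by simp
  qed
  have "bump v K \<alpha> s \<bullet>c bump v K' \<alpha>' s' =
    (\<Sum>l<v. (of_bool (l = s) + \<alpha> * of_bool (l \<in> K)) * cnj (of_bool (l = s') + \<alpha>' * of_bool (l \<in> K')))"
    by (simp add: scalar_prod_def bump_def atLeast0LessThan)
  \<comment> \<open>Wherever a Kronecker delta occurs, the other factor can be evaluated at its
    index; only the overlap of \<open>K\<close> and \<open>K'\<close> is left to be counted.\<close>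
  also have "\<dots> = (\<Sum>l<v. of_bool (l = s) * of_bool (s = s')) + (\<Sum>l<v. of_bool (l = s) * (cnj \<alpha>' * of_bool (s \<in> K')))
     + (\<Sum>l<v. of_bool (l = s') * (\<alpha> * of_bool (s' \<in> K))) + (\<Sum>l<v. \<alpha> * cnj \<alpha>' * of_bool (l \<in> K \<inter> K'))"
    unfolding sum.distrib[symmetric] by (intro sum.cong) (auto simp: algebra_simps)
  also have "(\<Sum>l<v. \<alpha> * cnj \<alpha>' * of_bool (l \<in> K \<inter> K')) = \<alpha> * cnj \<alpha>' * of_nat (card (K \<inter> K'))"
  proof -
    have "{..<v} \<inter> {l. l \<in> K \<inter> K'} = K \<inter> K'" using K by auto
    then show ?thesis by (simp add: sum_distrib_left[symmetric] sum.If_cases del: Int_iff)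
  qed
  finally show ?thesis using s by (simp only: delta)
qed

lemma same_global_phase_bumpD:
  assumes "same_global_phase (bump v K \<alpha> s) (bump v K' \<alpha>' s')"
  obtains \<mu> where "cmod \<mu> = 1"
    "\<And>l. l < v \<Longrightarrow> of_bool (l = s) + \<alpha> * of_bool (l \<in> K) = \<mu> * (of_bool (l = s') + \<alpha>' * of_bool (l \<in> K'))"
proof -
  obtain \<theta> where \<theta>: "bump v K \<alpha> s = cis \<theta> \<cdot>\<^sub>v bump v K' \<alpha>' s'"
    using assms by (auto simp: same_global_phase_iff)
  show thesis
  proof (rule that[of "cis \<theta>"])
    fix l assume l: "l < v"
    then have "bump v K \<alpha> s $ l = cis \<theta> * bump v K' \<alpha>' s' $ l"
      unfolding \<theta> by (simp add: bump_def)
    then show "of_bool (l = s) + \<alpha> * of_bool (l \<in> K) = cis \<theta> * (of_bool (l = s') + \<alpha>' * of_bool (l \<in> K'))"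
      using l by (simp add: bump_index)
  qed simp
qed

lemma bump_phase_unit_unit:
  assumes "same_global_phase (bump v {} 0 s) (bump v {} 0 s')" "s < v" "s' < v"
  shows "s = s'"
  using assms(1)
proof (rule same_global_phase_bumpD)
  fix \<mu> :: complex assume "\<And>l. l < v \<Longrightarrow> of_bool (l = s) + 0 * of_bool (l \<in> {}) = \<mu> * (of_bool (l = s') + 0 * of_bool (l \<in> {}))"
  from this[OF assms(2)] show ?thesis by (auto simp: of_bool_def split: if_splits)
qed

text \<open>Adding 0 or 1 leaves the imaginary part positive. Hence a bump at
  \<open>s \<in> K\<close> has support exactly \<open>K\<close>.\<close>

lemma of_bool_plus_neq_0:
  fixes \<alpha> :: complex
  assumes "Im \<alpha> > 0"
  shows "of_bool b + \<alpha> \<noteq> 0"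
proof
  assume "of_bool b + \<alpha> = 0"
  then have "Im (of_bool b + \<alpha>) = 0" by simp
  then show False using assms by (cases b) auto
qed

text \<open>The support of the rotated vector has a second coordinate, away from \<open>s'\<close>,
  where the basis vector vanishes. This is where rotated sets of size 1 are excluded.\<close>

lemma bump_not_phase_unit:
  assumes K: "s \<in> K" "K \<subseteq> {..<v}" "2 \<le> card K" and \<alpha>: "Im \<alpha> > 0" and "s' < v"
  shows "\<not> same_global_phase (bump v K \<alpha> s) (bump v {} 0 s')"
proof
  assume "same_global_phase (bump v K \<alpha> s) (bump v {} 0 s')"
  then show False
  proof (rule same_global_phase_bumpD)
    fix \<mu> :: complex assume eq: "\<And>l. l < v \<Longrightarrow> of_bool (l = s) + \<alpha> * of_bool (l \<in> K) = \<mu> * (of_bool (l = s') + 0 * of_bool (l \<in> {}))"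
    have "K - {s'} \<noteq> {}"
      using K(3) card_mono[of "{s'}" K] by auto
    then obtain l where l: "l \<in> K" "l \<noteq> s'" "l < v" using K by auto
    then have "of_bool (l = s) + \<alpha> = 0" using eq[of l] by simp
    then show False using of_bool_plus_neq_0[OF \<alpha>] by simp
  qed
qed

text \<open>A phase preserves supports, so \<open>K = K'\<close>. If the peaks agree, comparing
  coordinates at the peak and away from it forces \<mu> = 1. If they differ, comparing at both peaks
  forces \<mu> = -1 and then 1 + \<alpha> = -\<alpha>', which the positive imaginary parts
  forbid.\<close>

lemma bump_phase_bump:
  assumes ph: "same_global_phase (bump v K \<alpha> s) (bump v K' \<alpha>' s')"
    and K: "s \<in> K" "K \<subseteq> {..<v}" "2 \<le> card K" and K': "s' \<in> K'" "K' \<subseteq> {..<v}"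
    and \<alpha>: "Im \<alpha> > 0" "Im \<alpha>' > 0"
  shows "K = K' \<and> \<alpha> = \<alpha>' \<and> s = s'"
  using ph
proof (rule same_global_phase_bumpD)
  fix \<mu> :: complex assume \<mu>: "cmod \<mu> = 1"
    and eq: "\<And>l. l < v \<Longrightarrow> of_bool (l = s) + \<alpha> * of_bool (l \<in> K) = \<mu> * (of_bool (l = s') + \<alpha>' * of_bool (l \<in> K'))"
  have \<mu>0: "\<mu> \<noteq> 0" using \<mu> by auto
  have KK: "K = K'"
  proof -
    have "l \<in> K \<longleftrightarrow> l \<in> K'" if l: "l < v" for l
    proof -
      have "l \<noteq> s" if "l \<notin> K" using that K by auto
      moreover have "l \<noteq> s'" if "l \<notin> K'" using that K' by auto
      ultimately show ?thesis
        using eq[OF l] of_bool_plus_neq_0[OF \<alpha>(1), of "l = s"] of_bool_plus_neq_0[OF \<alpha>(2), of "l = s'"] \<mu>0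
      by (cases "l \<in> K"; cases "l \<in> K'") auto
    qed
    then show ?thesis using K(2) K'(2) by auto
  qed
  show ?thesis
  proof (cases "s = s'")
    case True
    have "K - {s} \<noteq> {}"
      using K(3) card_mono[of "{s}" K] by auto
    then obtain l where l: "l \<in> K" "l \<noteq> s" by auto
    then have 1: "\<alpha> = \<mu> * \<alpha>'" using eq[of l] K KK True by auto
    have "1 + \<alpha> = \<mu> * (1 + \<alpha>')" using eq[of s] K KK True by auto
    then have "\<mu> = 1" using 1 by (simp add: algebra_simps)
    then show ?thesis using 1 KK True by simp
  next
    case False
    have 1: "1 + \<alpha> = \<mu> * \<alpha>'" using eq[of s] K KK False by auto
    have 2: "\<alpha> = \<mu> * (1 + \<alpha>')" using eq[of s'] K K' KK False by auto
    have "\<mu> = \<mu> * (1 + \<alpha>') - \<mu> * \<alpha>'" by (simp add: algebra_simps)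
    also have "\<dots> = -1" unfolding 1[symmetric] 2[symmetric] by simp
    finally have "\<mu> = -1" .
    with 1 have "Im (1 + \<alpha>) = Im (- \<alpha>')" by simp
    then show ?thesis using \<alpha> by simp
  qed
qed


section \<open>Rotations of a set of symbols\<close>

text \<open>
  For \<open>z\<close> of modulus 1 the matrix \<open>I + ((z - 1) / k) J\<close>, with \<open>J\<close> the all-one matrix of size
  \<open>k\<close>, is unitary.  Taking \<open>z\<close> in the open upper half plane ensures that no entry vanishes and
  excludes the coincidence of \<open>z\<close> and \<open>-z\<close>, whose columns agree up to phase when \<open>k = 2\<close>.
\<close>

definition coef :: "nat \<Rightarrow> nat \<Rightarrow> complex" where
  "coef n k = (cis (pi / (real n + 2)) - 1) / of_nat k"

text \<open>The shift by 2 keeps the denominators above 1, so every angle lies where sine is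
  positive and cosine is injective.\<close>

lemma angle_bounds: "0 < pi / (real n + 2)" "pi / (real n + 2) < pi"
proof -
  show "0 < pi / (real n + 2)" by simp
  have "pi * 1 < pi * (real n + 2)" by (rule mult_strict_left_mono) simp_all
  then show "pi / (real n + 2) < pi" by (simp add: divide_less_eq)
qed

lemma Im_coef_pos: "k > 0 \<Longrightarrow> Im (coef n k) > 0"
  unfolding coef_def using sin_gt_zero[OF angle_bounds[of n]] by simp

lemma coef_inject:
  assumes "coef n k = coef n' k" "k > 0"
  shows "n = n'"
proof -
  have "cis (pi / (real n + 2)) = cis (pi / (real n' + 2))"
    using assms by (simp add: coef_def)
  then have "Re (cis (pi / (real n + 2))) = Re (cis (pi / (real n' + 2)))"
    by (rule arg_cong)
  then have "cos (pi / (real n + 2)) = cos (pi / (real n' + 2))"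
    by (simp only: cis.sel)
  then have "pi / (real n + 2) = pi / (real n' + 2)"
    using angle_bounds[of n] angle_bounds[of n'] cos_inj_pi less_imp_le by blast
  then show ?thesis by simp
qed

text \<open>This is the part of \<open>bump_inner\<close> beyond the Kronecker delta for two symbols
  of one rotated set of size \<open>k\<close>. Multiplied by \<open>k\<close> it becomes \<open>(cnj
  z - 1) + (z - 1) + (z - 1) * (cnj z - 1) = z * cnj z - 1\<close>, which is 0.\<close>

lemma coef_unitary:
  assumes "k > 0"
  shows "cnj (coef n k) + coef n k + coef n k * cnj (coef n k) * of_nat k = 0"
proof -
  define z where "z = cis (pi / (real n + 2))"
  have z: "z * cnj z = 1" by (simp add: z_def cis_cnj cis_mult)
  have k: "coef n k * of_nat k = z - 1" using assms by (simp add: coef_def z_def)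
  have k': "cnj (coef n k) * of_nat k = cnj z - 1" using assms by (simp add: coef_def z_def)
  have "(cnj (coef n k) + coef n k + coef n k * cnj (coef n k) * of_nat k) * of_nat k
    = cnj (coef n k) * of_nat k + coef n k * of_nat k + (coef n k * of_nat k) * (cnj (coef n k) * of_nat k)"
    by (simp add: algebra_simps)
  also have "\<dots> = 0" unfolding k k' using z by (simp add: algebra_simps)
  finally show ?thesis using assms by simp
qed

text \<open>Each label receives its own angle through \<open>to_nat\<close>, so two blocks that
  rotate the same symbols still produce different vectors.\<close>

definition cell :: "nat \<Rightarrow> ('b::countable \<Rightarrow> nat set) \<Rightarrow> 'b \<Rightarrow> nat \<Rightarrow> complex vec" where
  "cell v K b s =
    (if s \<in> K b then bump v (K b) (coef (to_nat b) (card (K b))) s else bump v {} 0 s)"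

lemma cell_carrier [simp]: "cell v K b s \<in> carrier_vec v"
  by (simp add: cell_def)

lemma inj_on_lessThan_image:
  assumes "inj_on f {..<v}" "f ` {..<v} \<subseteq> {..<v::nat}"
  shows "f ` {..<v} = {..<v}"
  using assms by (intro endo_inj_surj) auto

text \<open>By the label condition, a line that meets label \<open>b\<close> has all of
  \<open>K b\<close> within that label. The rotated cells of one label are then columns of a unitary
  on the span of \<open>K b\<close>, and cells of different labels, or unrotated cells, have
  disjoint supports.\<close>

lemma orthonormal_line:
  assumes inj: "inj_on f {..<v}" "f ` {..<v} \<subseteq> {..<v}"
    and K: "\<And>b. K b \<subseteq> {..<v}"
    and lab: "\<And>i j. i < v \<Longrightarrow> j < v \<Longrightarrow> f j \<in> K (\<beta> i) \<Longrightarrow> \<beta> j = \<beta> i"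
  shows "orthonormal_basis v (map (\<lambda>j. cell v K (\<beta> j) (f j)) [0..<v])"
proof (rule orthonormal_basisI)
  fix i j assume ij: "i < v" "j < v"
  have lt: "f i < v" "f j < v" using inj ij by auto
  have eq: "f i = f j \<longleftrightarrow> i = j" using inj ij by (auto simp: inj_on_def)
  have fin: "finite (K b)" for b using K finite_subset by blast
  \<comment> \<open>Since \<open>f\<close> is onto, a common symbol stands somewhere in the line,
    and the cell there would have to carry both labels.\<close>
  have disj: "K (\<beta> i) \<inter> K (\<beta> j) = {}" if "\<beta> i \<noteq> \<beta> j"
  proof (rule ccontr)
    assume "K (\<beta> i) \<inter> K (\<beta> j) \<noteq> {}"
    then obtain s where s: "s \<in> K (\<beta> i)" "s \<in> K (\<beta> j)" by auto
    then obtain l where "l < v" "s = f l"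
      using inj_on_lessThan_image[OF inj] K by blast
    then show False using lab ij s that by metis
  qed
  have "cell v K (\<beta> i) (f i) \<bullet>c cell v K (\<beta> j) (f j) = (if i = j then 1 else 0)"
  proof (cases "f i \<in> K (\<beta> i)")
    case i: True
    show ?thesis
    proof (cases "f j \<in> K (\<beta> j)")
      case j: True
      show ?thesis
      proof (cases "\<beta> i = \<beta> j")
        case True
        have "card (K (\<beta> j)) > 0" using j fin by (auto simp: card_gt_0_iff)
        then show ?thesis using i j True lt K eq coef_unitary[of "card (K (\<beta> j))" "to_nat (\<beta> j)"]
          by (simp add: cell_def bump_inner add.assoc)
      next
        case False
        then have "f i \<notin> K (\<beta> j)" "f j \<notin> K (\<beta> i)" "i \<noteq> j" using disj i j by auto
        then show ?thesis using i j lt K eq disj[OF False] by (simp add: cell_def bump_inner)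
      qed
    next
      case False
      then have "f j \<notin> K (\<beta> i)" using lab[OF ij] by auto
      then show ?thesis using i False lt K eq by (simp add: cell_def bump_inner)
    qed
  next
    case i: False
    show ?thesis
    proof (cases "f j \<in> K (\<beta> j)")
      case True
      then have "f i \<notin> K (\<beta> j)" using lab[OF ij(2,1)] i by auto
      then show ?thesis using i True lt K eq by (simp add: cell_def bump_inner)
    next
      case False
      then show ?thesis using i lt K eq by (simp add: cell_def bump_inner)
    qed
  qed
  then show "map (\<lambda>j. cell v K (\<beta> j) (f j)) [0..<v] ! i \<bullet>c map (\<lambda>j. cell v K (\<beta> j) (f j)) [0..<v] ! j
      = (if i = j then 1 else 0)"
    using ij by simp
qed auto

section \<open>From labelled Latin squares to quantum Latin squares of known cardinality\<close>

lemma qls_cardinality_eq_card: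
  assumes "\<And>u w. u \<in> elements_mat \<Phi> \<Longrightarrow> w \<in> elements_mat \<Phi> \<Longrightarrow> same_global_phase u w \<Longrightarrow> u = w"
  shows "qls_cardinality \<Phi> = card (elements_mat \<Phi>)"
proof -
  have "same_global_phase u u" for u
    unfolding same_global_phase_iff by (rule exI[of _ 0]) simp
  then have "phase_rel (elements_mat \<Phi>) = Id_on (elements_mat \<Phi>)"
    using assms by (auto simp: phase_rel_def Id_on_def)
  then have "elements_mat \<Phi> // phase_rel (elements_mat \<Phi>) = (\<lambda>u. {u}) ` elements_mat \<Phi>"
    by (auto simp: quotient_def)
  then show ?thesis by (simp add: qls_cardinality_def card_image)
qed

text \<open>
  \<open>K b\<close> is the set of symbols rotated in the cells labelled \<open>b\<close>; the two label conditions say that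
  a line meeting label \<open>b\<close> carries all symbols of \<open>K b\<close> inside label \<open>b\<close>.
\<close>

lemma qls_of_labelled_latin_square_nat:
  fixes L :: "nat \<Rightarrow> nat \<Rightarrow> nat" and \<beta> :: "nat \<Rightarrow> nat \<Rightarrow> 'b::countable"
  assumes range: "\<And>x y. x < v \<Longrightarrow> y < v \<Longrightarrow> L x y < v"
    and row_inj: "\<And>x. x < v \<Longrightarrow> inj_on (L x) {..<v}"
    and col_inj: "\<And>y. y < v \<Longrightarrow> inj_on (\<lambda>x. L x y) {..<v}"
    and K: "\<And>b. K b \<subseteq> {..<v}" "\<And>b. card (K b) \<noteq> 1"
    and fin: "finite {b. K b \<noteq> {}}"
    and row_lab: "\<And>x y y'. x < v \<Longrightarrow> y < v \<Longrightarrow> y' < v \<Longrightarrow> L x y' \<in> K (\<beta> x y) \<Longrightarrow> \<beta> x y' = \<beta> x y"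
    and col_lab: "\<And>x x' y. x < v \<Longrightarrow> x' < v \<Longrightarrow> y < v \<Longrightarrow> L x' y \<in> K (\<beta> x y) \<Longrightarrow> \<beta> x' y = \<beta> x y"
    and used: "\<And>b. K b \<noteq> {} \<Longrightarrow> \<exists>x<v. \<exists>y<v. \<beta> x y = b"
    and survive: "\<And>s. s < v \<Longrightarrow> \<exists>x<v. \<exists>y<v. L x y = s \<and> s \<notin> K (\<beta> x y)"
  shows "\<exists>\<Phi>. quantum_latin_square v \<Phi> \<and> qls_cardinality \<Phi> = v + (\<Sum>b | K b \<noteq> {}. card (K b))"
proof -
  define \<Phi> where "\<Phi> = mat v v (\<lambda>(x, y). cell v K (\<beta> x y) (L x y))"
  \<comment> \<open>\<open>P\<close> holds the unrotated basis vectors; \<open>Q\<close> indexes the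
    rotated vectors by label and symbol. The entries will be shown to be exactly these, with no two
    sharing a phase.\<close>
  define P where "P = (\<lambda>s. bump v {} 0 s) ` {..<v}"
  define h where "h = (\<lambda>(b, s). bump v (K b) (coef (to_nat b) (card (K b))) s)"
  define Q where "Q = Sigma {b. K b \<noteq> {}} K"
  have finK: "finite (K b)" for b using K finite_subset by blast
  have card2: "2 \<le> card (K b)" if "s \<in> K b" for b s
  proof -
    have "card (K b) \<noteq> 0" using that finK by auto
    then show ?thesis using K(2)[of b] by linarith
  qed
  have im: "Im (coef n (card (K b))) > 0" if "s \<in> K b" for b s n
    using card2[OF that] by (intro Im_coef_pos) simp
  have qls: "quantum_latin_square v \<Phi>"
    unfolding quantum_latin_square_def
  proof (intro conjI allI impI)
    fix i assume i: "i < v"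
    have row: "list_of_vec (row \<Phi> i) = map (\<lambda>j. cell v K (\<beta> i j) (L i j)) [0..<v]"
      using i by (simp add: \<Phi>_def)
    show "orthonormal_basis v (list_of_vec (row \<Phi> i))"
      unfolding row
    proof (rule orthonormal_line)
      show "L i ` {..<v} \<subseteq> {..<v}" using range[OF i] by auto
    qed (fact row_inj[OF i] K(1) row_lab[OF i])+
  next
    fix j assume j: "j < v"
    have col: "list_of_vec (col \<Phi> j) = map (\<lambda>i. cell v K (\<beta> i j) (L i j)) [0..<v]"
      using j by (simp add: \<Phi>_def)
    show "orthonormal_basis v (list_of_vec (col \<Phi> j))"
      unfolding col
    proof (rule orthonormal_line)
      show "(\<lambda>i. L i j) ` {..<v} \<subseteq> {..<v}" using range[OF _ j] by auto
    qed (fact col_inj[OF j] K(1) col_lab[OF _ _ j])+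
  qed (simp add: \<Phi>_def)
  have "elements_mat \<Phi> = (\<lambda>(x, y). cell v K (\<beta> x y) (L x y)) ` ({..<v} \<times> {..<v})"
    by (auto simp: elements_mat_def \<Phi>_def)
  also have "\<dots> = P \<union> h ` Q"
  proof (intro equalityI subsetI)
    fix u assume "u \<in> (\<lambda>(x, y). cell v K (\<beta> x y) (L x y)) ` ({..<v} \<times> {..<v})"
    then obtain x y where xy: "x < v" "y < v" and u: "u = cell v K (\<beta> x y) (L x y)" by auto
    show "u \<in> P \<union> h ` Q"
    proof (cases "L x y \<in> K (\<beta> x y)")
      case True
      then have "u = h (\<beta> x y, L x y)" "(\<beta> x y, L x y) \<in> Q"
        by (auto simp: u cell_def h_def Q_def)
      then show ?thesis by blast
    qed (use xy range in \<open>auto simp: u cell_def P_def\<close>)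
  next
    fix u assume "u \<in> P \<union> h ` Q"
    then show "u \<in> (\<lambda>(x, y). cell v K (\<beta> x y) (L x y)) ` ({..<v} \<times> {..<v})"
    proof
      assume "u \<in> P"
      then obtain s where s: "s < v" "u = bump v {} 0 s" by (auto simp: P_def)
      then obtain x y where "x < v" "y < v" "L x y = s" "s \<notin> K (\<beta> x y)"
        using survive by blast
      then show ?thesis using s by (intro image_eqI[of _ _ "(x, y)"]) (auto simp: cell_def)
    next
      assume "u \<in> h ` Q"
      then obtain b s where s: "s \<in> K b" "u = h (b, s)" by (auto simp: Q_def)
      then obtain x y where xy: "x < v" "y < v" "\<beta> x y = b" using used by blast
      \<comment> \<open>A row meeting label \<open>b\<close> contains every symbol, and the row
        label condition puts its occurrence of \<open>s\<close> inside label \<open>b\<close>; so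
        the rotated vector really is an entry.\<close>
      have "s \<in> L x ` {..<v}"
        using inj_on_lessThan_image[OF row_inj[OF xy(1)]] range[OF xy(1)] K s by blast
      then obtain y' where y': "y' < v" "L x y' = s" by auto
      then have "\<beta> x y' = b" using row_lab[OF xy(1,2) y'(1)] xy s by simp
      then show ?thesis using s xy y'
        by (intro image_eqI[of _ _ "(x, y')"]) (auto simp: cell_def h_def)
    qed
  qed
  finally have E: "elements_mat \<Phi> = P \<union> h ` Q" .
  have PP: "s = s'" if "same_global_phase (bump v {} 0 s) (bump v {} 0 s')" "s < v" "s' < v" for s s'
    using bump_phase_unit_unit that by blast
  have QP: "\<not> same_global_phase (h p) (bump v {} 0 s)" if "p \<in> Q" "s < v" for p s
  proof -
    obtain b r where "p = (b, r)" "r \<in> K b" using \<open>p \<in> Q\<close> by (auto simp: Q_def)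
    then show ?thesis
      using bump_not_phase_unit[OF _ K(1) card2 im \<open>s < v\<close>] by (simp add: h_def)
  qed
  have QQ: "p = p'" if ph: "same_global_phase (h p) (h p')" and "p \<in> Q" "p' \<in> Q" for p p'
  proof -
    obtain b s b' s' where p: "p = (b, s)" "p' = (b', s')" "s \<in> K b" "s' \<in> K b'"
      using \<open>p \<in> Q\<close> \<open>p' \<in> Q\<close> by (auto simp: Q_def)
    \<comment> \<open>Different labels may have the same symbol set. Once the sets agree, the two
      coefficients have the same size parameter, and \<open>coef_inject\<close> separates the
      labels.\<close>
    have "K b = K b' \<and> coef (to_nat b) (card (K b)) = coef (to_nat b') (card (K b')) \<and> s = s'"
      using ph[unfolded p h_def prod.case]
      by (rule bump_phase_bump[OF _ p(3) K(1) card2[OF p(3)] p(4) K(1) im[OF p(3)] im[OF p(4)]])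
    then have "coef (to_nat b) (card (K b)) = coef (to_nat b') (card (K b))" "s = s'" by metis+
    moreover have "card (K b) > 0" using card2[OF p(3)] by simp
    ultimately show ?thesis using p coef_inject[of "to_nat b" "card (K b)" "to_nat b'"] by simp
  qed
  have sym: "same_global_phase w u" if uw: "same_global_phase u w" for u w
  proof -
    obtain \<theta> where "u = cis \<theta> \<cdot>\<^sub>v w" using uw by (auto simp: same_global_phase_iff)
    then have "w = cis (- \<theta>) \<cdot>\<^sub>v u" by (simp add: smult_smult_assoc cis_mult)
    then show ?thesis by (auto simp: same_global_phase_iff)
  qed
  have refl: "same_global_phase u u" for u
    unfolding same_global_phase_iff by (rule exI[of _ 0]) simp
  have "qls_cardinality \<Phi> = card (elements_mat \<Phi>)"
  proof (rule qls_cardinality_eq_card)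
    have cases: "(\<exists>s<v. u = bump v {} 0 s) \<or> (\<exists>p\<in>Q. u = h p)" if "u \<in> P \<union> h ` Q" for u
      using that by (auto simp: P_def)
    fix u w assume u: "u \<in> elements_mat \<Phi>" and w: "w \<in> elements_mat \<Phi>"
      and uw: "same_global_phase u w"
    show "u = w"
      using cases[OF u[unfolded E]]
    proof (elim disjE exE bexE conjE)
      fix s assume s: "s < v" "u = bump v {} 0 s"
      then have "\<not> (\<exists>p\<in>Q. w = h p)" using QP sym[OF uw] by blast
      then obtain s' where "s' < v" "w = bump v {} 0 s'" using cases[OF w[unfolded E]] by blast
      then show ?thesis using s PP[of s s'] uw by simp
    next
      fix p assume p: "p \<in> Q" "u = h p"
      then have "\<not> (\<exists>s<v. w = bump v {} 0 s)" using QP uw by blast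
      then obtain p' where "p' \<in> Q" "w = h p'" using cases[OF w[unfolded E]] by blast
      then show ?thesis using p QQ[of p p'] uw by simp
    qed
  qed
  also have "\<dots> = card P + card (h ` Q)"
    unfolding E
  proof (rule card_Un_disjoint)
    show "finite (h ` Q)" using fin finK by (auto simp: Q_def)
    show "P \<inter> h ` Q = {}"
    proof (rule ccontr)
      assume "P \<inter> h ` Q \<noteq> {}"
      then obtain u where "u \<in> P" "u \<in> h ` Q" by blast
      then obtain s p where "s < v" "u = bump v {} 0 s" "p \<in> Q" "u = h p"
        unfolding P_def by blast
      then show False using QP[of p s] refl[of u] by simp
    qed
  qed (simp add: P_def)
  also have "card P = v"
  proof -
    have "inj_on (bump v {} 0) {..<v}"
    proof (rule inj_onI)
      fix s s' assume "s \<in> {..<v}" "s' \<in> {..<v}" "bump v {} 0 s = bump v {} 0 s'"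
      then show "s = s'" using PP[of s s'] refl[of "bump v {} 0 s"] by simp
    qed
    then show ?thesis by (simp add: P_def card_image)
  qed
  also have "card (h ` Q) = card Q"
  proof (intro card_image inj_onI)
    fix p p' assume "p \<in> Q" "p' \<in> Q" "h p = h p'"
    then show "p = p'" using QQ[of p p'] refl[of "h p"] by simp
  qed
  also have "card Q = (\<Sum>b | K b \<noteq> {}. card (K b))"
    unfolding Q_def using fin finK by (intro card_SigmaI) auto
  finally show ?thesis using qls by blast
qed

text \<open>A bijection from \<open>X\<close> to \<open>{..<v}\<close> transports the square; labels
  are kept and each \<open>K b\<close> is replaced by its image, which has the same size. This
  permits an index set with block structure.\<close>

lemma qls_of_labelled_latin_square:
  fixes L :: "'a \<Rightarrow> 'a \<Rightarrow> 'a" and \<beta> :: "'a \<Rightarrow> 'a \<Rightarrow> 'b::countable"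
  assumes X: "finite X" "card X = v"
    and range: "\<And>x y. x \<in> X \<Longrightarrow> y \<in> X \<Longrightarrow> L x y \<in> X"
    and row_inj: "\<And>x. x \<in> X \<Longrightarrow> inj_on (L x) X"
    and col_inj: "\<And>y. y \<in> X \<Longrightarrow> inj_on (\<lambda>x. L x y) X"
    and K: "\<And>b. K b \<subseteq> X" "\<And>b. card (K b) \<noteq> 1"
    and fin: "finite {b. K b \<noteq> {}}"
    and row_lab: "\<And>x y y'. x \<in> X \<Longrightarrow> y \<in> X \<Longrightarrow> y' \<in> X \<Longrightarrow> L x y' \<in> K (\<beta> x y) \<Longrightarrow> \<beta> x y' = \<beta> x y"
    and col_lab: "\<And>x x' y. x \<in> X \<Longrightarrow> x' \<in> X \<Longrightarrow> y \<in> X \<Longrightarrow> L x' y \<in> K (\<beta> x y) \<Longrightarrow> \<beta> x' y = \<beta> x y"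
    and used: "\<And>b. K b \<noteq> {} \<Longrightarrow> \<exists>x\<in>X. \<exists>y\<in>X. \<beta> x y = b"
    and survive: "\<And>s. s \<in> X \<Longrightarrow> \<exists>x\<in>X. \<exists>y\<in>X. L x y = s \<and> s \<notin> K (\<beta> x y)"
  shows "\<exists>\<Phi>. quantum_latin_square v \<Phi> \<and> qls_cardinality \<Phi> = v + (\<Sum>b | K b \<noteq> {}. card (K b))"
proof -
  obtain g where "bij_betw g X {..<v}"
    using ex_bij_betw_finite_nat[OF X(1)] X(2) by (auto simp: atLeast0LessThan)
  define h where "h = inv_into X g"
  have g: "inj_on g X" "\<And>x. x \<in> X \<Longrightarrow> g x < v"
    and h: "\<And>i. i < v \<Longrightarrow> h i \<in> X" "\<And>i. i < v \<Longrightarrow> g (h i) = i" "\<And>x. x \<in> X \<Longrightarrow> h (g x) = x"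
    using \<open>bij_betw g X {..<v}\<close> unfolding h_def
    by (auto simp: bij_betw_def inv_into_into f_inv_into_f)
  have g_eq: "g x = g y \<longleftrightarrow> x = y" if "x \<in> X" "y \<in> X" for x y
    using g(1) that by (auto simp: inj_on_def)
  have g_mem: "g x \<in> g ` K b \<longleftrightarrow> x \<in> K b" if "x \<in> X" for x b
    using inj_on_image_mem_iff[OF g(1) that K(1)] .
  have inj_h: "inj_on h {..<v}" by (rule inj_on_inverseI[of _ g]) (simp add: h(2))
  have card_g: "card (g ` K b) = card (K b)" for b
    by (rule card_image[OF inj_on_subset[OF g(1) K(1)]])
  have "\<exists>\<Phi>. quantum_latin_square v \<Phi> \<and>
      qls_cardinality \<Phi> = v + (\<Sum>b | g ` K b \<noteq> {}. card (g ` K b))"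
  proof (rule qls_of_labelled_latin_square_nat[where L = "\<lambda>i j. g (L (h i) (h j))"
        and \<beta> = "\<lambda>i j. \<beta> (h i) (h j)"])
    fix x assume x: "x < v"
    show "inj_on (\<lambda>j. g (L (h x) (h j))) {..<v}"
    proof (rule inj_onI)
      fix j j' assume j: "j \<in> {..<v}" "j' \<in> {..<v}" "g (L (h x) (h j)) = g (L (h x) (h j'))"
      then have "L (h x) (h j) = L (h x) (h j')"
        using g_eq range h(1) x by simp
      then have "h j = h j'"
        by (rule inj_onD[OF row_inj[OF h(1)[OF x]]]) (use h(1) j in simp_all)
      then show "j = j'" by (rule inj_onD[OF inj_h]) (use j in simp_all)
    qed
  next
    fix y assume y: "y < v"
    show "inj_on (\<lambda>i. g (L (h i) (h y))) {..<v}"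
    proof (rule inj_onI)
      fix i i' assume i: "i \<in> {..<v}" "i' \<in> {..<v}" "g (L (h i) (h y)) = g (L (h i') (h y))"
      then have "L (h i) (h y) = L (h i') (h y)"
        using g_eq range h(1) y by simp
      then have "h i = h i'"
        by (rule inj_onD[OF col_inj[OF h(1)[OF y]]]) (use h(1) i in simp_all)
      then show "i = i'" by (rule inj_onD[OF inj_h]) (use i in simp_all)
    qed
  next
    fix b
    show "g ` K b \<subseteq> {..<v}" using K(1)[of b] g(2) by auto
  next
    fix b assume "g ` K b \<noteq> {}"
    then obtain x y where xy: "x \<in> X" "y \<in> X" "\<beta> x y = b" using used[of b] by auto
    then show "\<exists>x<v. \<exists>y<v. \<beta> (h x) (h y) = b"
      using g(2) h(3) by (intro exI[of _ "g x"] conjI exI[of _ "g y"]) simp_all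
  next
    fix s assume s: "s < v"
    obtain x y where xy: "x \<in> X" "y \<in> X" "L x y = h s" "h s \<notin> K (\<beta> x y)"
      using survive[OF h(1)[OF s]] by blast
    moreover have "s \<notin> g ` K (\<beta> x y)"
      using g_mem[OF h(1)[OF s], of "\<beta> x y"] xy(4) h(2)[OF s] by simp
    ultimately show "\<exists>x<v. \<exists>y<v. g (L (h x) (h y)) = s \<and> s \<notin> g ` K (\<beta> (h x) (h y))"
      using s g(2) h by (intro exI[of _ "g x"] conjI exI[of _ "g y"]) simp_all
  next
    fix x y y' assume "x < v" "y < v" "y' < v" "g (L (h x) (h y')) \<in> g ` K (\<beta> (h x) (h y))"
    then show "\<beta> (h x) (h y') = \<beta> (h x) (h y)"
      using row_lab[of "h x" "h y" "h y'"] by (simp add: h(1) range g_mem)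
  next
    fix x x' y assume "x < v" "x' < v" "y < v" "g (L (h x') (h y)) \<in> g ` K (\<beta> (h x) (h y))"
    then show "\<beta> (h x') (h y) = \<beta> (h x) (h y)"
      using col_lab[of "h x" "h x'" "h y"] by (simp add: h(1) range g_mem)
  qed (use range h(1) g(2) card_g K(2) fin in simp_all)
  then show ?thesis by (simp add: card_g)
qed

section \<open>Idempotent Latin squares of every order at least 3\<close>

definition idempotent_latin :: "nat \<Rightarrow> (nat \<Rightarrow> nat \<Rightarrow> nat) \<Rightarrow> bool" where
  "idempotent_latin t f \<longleftrightarrow>
     (\<forall>i<t. \<forall>j<t. f i j < t) \<and> (\<forall>i<t. inj_on (f i) {..<t}) \<and>
     (\<forall>j<t. inj_on (\<lambda>i. f i j) {..<t}) \<and> (\<forall>i<t. f i i = i)"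

lemma idempotent_latin_transpose: "idempotent_latin t f \<Longrightarrow> idempotent_latin t (\<lambda>i j. f j i)"
  by (auto simp: idempotent_latin_def)

lemma idempotent_latin_less: "idempotent_latin t f \<Longrightarrow> i < t \<Longrightarrow> j < t \<Longrightarrow> f i j < t"
  by (simp add: idempotent_latin_def)

lemma idempotent_latin_diag: "idempotent_latin t f \<Longrightarrow> i < t \<Longrightarrow> f i i = i"
  by (simp add: idempotent_latin_def)

lemma idempotent_latin_row_eq_iff:
  assumes "idempotent_latin t f" "i < t" "j < t" "j' < t"
  shows "f i j = f i j' \<longleftrightarrow> j = j'"
proof -
  have "inj_on (f i) {..<t}" using assms by (simp add: idempotent_latin_def)
  then show ?thesis using assms by (simp add: inj_on_eq_iff)
qed

lemma eq_if_dvd_diff: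
  assumes "int n dvd int i - int j" "i < n" "j < n"
  shows "i = j"
proof (rule ccontr)
  assume "i \<noteq> j"
  then have "\<bar>int n\<bar> \<le> \<bar>int i - int j\<bar>" using assms(1) by (intro dvd_imp_le_int) auto
  then show False using assms(2,3) by linarith
qed

text \<open>Reflection of \<open>j\<close> in \<open>i\<close> modulo \<open>n\<close> (the dihedral
  quandle): \<open>i\<close> is the midpoint of \<open>j\<close> and the value. The integers avoid
  truncated subtraction.\<close>

definition mid :: "nat \<Rightarrow> nat \<Rightarrow> nat \<Rightarrow> nat" where
  "mid n i j = nat ((2 * int i - int j) mod int n)"

lemma mid_eqD:
  assumes "n > 0" "mid n i j = mid n i' j'"
  shows "int n dvd (2 * int i - int j) - (2 * int i' - int j')"
proof -
  have "(2 * int i - int j) mod int n = (2 * int i' - int j') mod int n"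
    using assms by (simp add: mid_def eq_nat_nat_iff)
  then show ?thesis by (simp only: mod_eq_dvd_iff)
qed

lemma idempotent_latin_mid:
  assumes "odd n"
  shows "idempotent_latin n (mid n)"
  unfolding idempotent_latin_def
proof (intro conjI allI impI)
  have n: "n > 0" using assms by (cases n) auto
  fix i assume i: "i < n"
  show "mid n i j < n" for j
    using n by (simp add: mid_def nat_less_iff)
  show "inj_on (mid n i) {..<n}"
  proof (rule inj_onI)
    fix j j' assume j: "j \<in> {..<n}" "j' \<in> {..<n}" "mid n i j = mid n i j'"
    have "int n dvd int j' - int j" using mid_eqD[OF n j(3)] by simp
    then show "j = j'" using j eq_if_dvd_diff[of n j' j] by simp
  qed
  show "inj_on (\<lambda>j. mid n j i) {..<n}"
  proof (rule inj_onI)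
    fix j j' assume j: "j \<in> {..<n}" "j' \<in> {..<n}" "mid n j i = mid n j' i"
    \<comment> \<open>Here oddness enters: 2 is invertible modulo \<open>n\<close> and can be
      cancelled.\<close>
    have "int n dvd 2 * (int j - int j')" using mid_eqD[OF n j(3)] by (simp add: algebra_simps)
    moreover have "coprime (int n) 2" using assms by simp
    ultimately have "int n dvd int j - int j'" using coprime_dvd_mult_right_iff by blast
    then show "j = j'" using j eq_if_dvd_diff[of n j j'] by simp
  qed
  show "mid n i i = i" using i by (simp add: mid_def)
qed

text \<open>The classical prolongation along a transversal: its cell in row \<open>i\<close> is in
  column \<open>p i\<close>, and \<open>q\<close> is meant to be the inverse of \<open>p\<close>.
  Each symbol on it is pushed out to the new column and the new row, and the new symbol
  \<open>n\<close> takes its place and fills the corner.\<close>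

definition prolong :: "nat \<Rightarrow> (nat \<Rightarrow> nat \<Rightarrow> nat) \<Rightarrow> (nat \<Rightarrow> nat) \<Rightarrow> (nat \<Rightarrow> nat) \<Rightarrow> nat \<Rightarrow> nat \<Rightarrow> nat" where
  "prolong n f p q i j =
    (if i < n \<and> j < n then if j = p i then n else f i j
     else if i < n then f i (p i) else if j < n then f (q j) j else n)"

text \<open>An old row merely has one symbol moved to the last column and \<open>n\<close> put in
  the gap. The new row lists the symbols of the transversal followed by \<open>n\<close>, so it
  needs those symbols to be distinct.\<close>

lemma prolong_row_inj:
  assumes f: "idempotent_latin n f"
    and p: "\<And>i. i < n \<Longrightarrow> p i < n" and q: "\<And>j. j < n \<Longrightarrow> q j < n"
    and inj: "inj_on (\<lambda>j. f (q j) j) {..<n}"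
    and i: "i < Suc n"
  shows "inj_on (prolong n f p q i) {..<Suc n}"
proof (rule inj_onI)
  fix j j' assume j: "j \<in> {..<Suc n}" "j' \<in> {..<Suc n}" and eq: "prolong n f p q i j = prolong n f p q i j'"
  have rng: "f a b \<noteq> n" if "a < n" "b < n" for a b
  proof -
    have "f a b < n" using f that by (simp add: idempotent_latin_def)
    then show ?thesis by simp
  qed
  show "j = j'"
  proof (cases "i < n")
    case True
    note row = idempotent_latin_row_eq_iff[OF f True]
    have val: "prolong n f p q i a = (if a = n then f i (p i) else if a = p i then n else f i a)"
      if "a < Suc n" for a
      using that True p[OF True] by (auto simp: prolong_def)
    have "(if j = n then f i (p i) else if j = p i then n else f i j)
        = (if j' = n then f i (p i) else if j' = p i then n else f i j')"
      using eq val[of j] val[of j'] j by (simp only: lessThan_iff)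
    moreover have "j = n \<or> j < n" "j' = n \<or> j' < n" using j by auto
    ultimately show ?thesis
      using rng[OF True, of j] rng[OF True, of j'] rng[OF True, of "p i"] p[OF True]
        row[of j j'] row[of j "p i"] row[of "p i" j'] by (smt (verit))
  next
    case False
    have val: "prolong n f p q i a = (if a = n then n else f (q a) a)" if "a < Suc n" for a
      using that False by (auto simp: prolong_def)
    have "(if j = n then n else f (q j) j) = (if j' = n then n else f (q j') j')"
      using eq val[of j] val[of j'] j by (simp only: lessThan_iff)
    moreover have "j = n \<or> j \<in> {..<n}" "j' = n \<or> j' \<in> {..<n}" using j by auto
    ultimately show ?thesis
      using rng[OF q, of j j] rng[OF q, of j' j'] inj_on_eq_iff[OF inj, of j j']
      unfolding lessThan_iff by (smt (verit))
  qed
qed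

text \<open>Since \<open>p\<close> has no fixed point, the transversal avoids the diagonal, which
  therefore stays idempotent. Columns are handled as rows of the transposed square.\<close>

lemma idempotent_latin_prolong:
  assumes f: "idempotent_latin n f"
    and p: "\<And>i. i < n \<Longrightarrow> p i < n" "\<And>i. i < n \<Longrightarrow> p i \<noteq> i"
    and q: "\<And>j. j < n \<Longrightarrow> q j < n" "\<And>i. i < n \<Longrightarrow> q (p i) = i" "\<And>j. j < n \<Longrightarrow> p (q j) = j"
    and inj: "inj_on (\<lambda>i. f i (p i)) {..<n}"
  shows "idempotent_latin (Suc n) (prolong n f p q)"
proof -
  have inj': "inj_on (\<lambda>j. f (q j) j) {..<n}"
  proof (rule inj_onI)
    fix j j' assume j: "j \<in> {..<n}" "j' \<in> {..<n}" "f (q j) j = f (q j') j'"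
    have "q j = q j'" by (rule inj_onD[OF inj]) (use j q(1,3) in simp_all)
    then have "p (q j) = p (q j')" by (rule arg_cong)
    then show "j = j'" using q(3) j(1,2) by simp
  qed
  \<comment> \<open>Both sides say that \<open>(i, j)\<close> lies on the transversal; so
    transposing exchanges \<open>p\<close> and \<open>q\<close>.\<close>
  have pq: "j = p i \<longleftrightarrow> i = q j" if "i < n" "j < n" for i j
    using q(2)[OF that(1)] q(3)[OF that(2)] by auto
  have transpose: "(\<lambda>i. prolong n f p q i j) = prolong n (\<lambda>i j. f j i) q p j" for j
  proof
    fix i
    show "prolong n f p q i j = prolong n (\<lambda>i j. f j i) q p j i"
      using pq[of i j] by (cases "i < n"; cases "j < n") (simp_all add: prolong_def)
  qed
  have rng: "f i j < Suc n" if "i < n" "j < n" for i j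
    using f that by (simp add: idempotent_latin_def less_SucI)
  show ?thesis
    unfolding idempotent_latin_def
  proof (intro conjI allI impI)
    fix i assume i: "i < Suc n"
    show "inj_on (prolong n f p q i) {..<Suc n}"
      by (rule prolong_row_inj[OF f p(1) q(1) inj' i])
    show "inj_on (\<lambda>k. prolong n f p q k i) {..<Suc n}"
      unfolding transpose
      by (rule prolong_row_inj[OF idempotent_latin_transpose[OF f] q(1) p(1) inj i])
    show "prolong n f p q i i = i"
      using i f p(2)[of i] by (auto simp: prolong_def idempotent_latin_def)
    show "prolong n f p q i j < Suc n" if "j < Suc n" for j
      using i that rng p(1) q(1) by (simp add: prolong_def)
  qed
qed

lemma ex_idempotent_latin:
  assumes "t \<ge> 3"
  shows "\<exists>f. idempotent_latin t f"
proof (cases "odd t")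
  case False
  define n where "n = t - 1"
  have n: "odd n" "n \<ge> 3" "t = Suc n" using False assms by (auto simp: n_def) presburger+
  \<comment> \<open>The transversal is the cyclic successor. Its symbol in row \<open>i\<close> is
    \<open>2 * i - (i + 1) = i - 1\<close> modulo \<open>n\<close>, so all its symbols are
    distinct.\<close>
  define p where "p i = (if Suc i = n then 0 else Suc i)" for i
  define q where "q j = (if j = 0 then n - 1 else j - 1)" for j :: nat
  have "idempotent_latin (Suc n) (prolong n (mid n) p q)"
  proof (rule idempotent_latin_prolong[OF idempotent_latin_mid[OF n(1)]])
    show "inj_on (\<lambda>i. mid n i (p i)) {..<n}"
    proof (rule inj_onI)
      fix i i' assume i: "i \<in> {..<n}" "i' \<in> {..<n}" "mid n i (p i) = mid n i' (p i')"
      have p: "int n dvd int (p i) - int i - 1" for i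
      proof -
        have "int (p i) - int i - 1 = (if Suc i = n then - int n else 0)" by (auto simp: p_def)
        then show ?thesis by simp
      qed
      have "int n dvd (2 * int i - int (p i)) - (2 * int i' - int (p i'))"
        using mid_eqD[OF _ i(3)] n(2) by simp
      \<comment> \<open>Adding the congruences for \<open>p\<close> cancels \<open>p i\<close> and
        \<open>p i'\<close> and leaves just \<open>i - i'\<close>.\<close>
      from dvd_add[OF this dvd_diff[OF p[of i] p[of i']]]
      have "int n dvd ((2 * int i - int (p i)) - (2 * int i' - int (p i')))
          + ((int (p i) - int i - 1) - (int (p i') - int i' - 1))" .
      then have "int n dvd int i - int i'" by (simp add: algebra_simps)
      then show "i = i'" using i eq_if_dvd_diff by simp
    qed
  qed (use n(2) in \<open>auto simp: p_def q_def split: if_splits\<close>)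
  then show ?thesis using n(3) by blast
qed (use idempotent_latin_mid in blast)

section \<open>The blown-up square with an added point, and its blocks\<close>

text \<open>Numbers the points of diagonal block \<open>i\<close> by residues modulo
  \<open>m + 1\<close>; the added point \<open>None\<close> is residue 0 in every block.\<close>

definition point :: "nat \<Rightarrow> nat \<Rightarrow> (nat \<times> nat) option" where
  "point i k = (case k of 0 \<Rightarrow> None | Suc a \<Rightarrow> Some (i, a))"

definition points :: "nat \<Rightarrow> nat \<Rightarrow> (nat \<times> nat) option set" where
  "points t m = insert None (Some ` ({..<t} \<times> {..<m}))"

text \<open>In \<open>point\<close> coordinates a diagonal block with the added point is the
  addition table modulo \<open>m + 1\<close>. The added point is its zero, which makes the border
  rows and columns identities and lets all these tables share the corner. Off the diagonal, addition
  modulo \<open>m\<close> fills a block with copies of \<open>f i j\<close>.\<close>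

fun square :: "(nat \<Rightarrow> nat \<Rightarrow> nat) \<Rightarrow> nat \<Rightarrow> (nat \<times> nat) option \<Rightarrow> (nat \<times> nat) option \<Rightarrow> (nat \<times> nat) option" where
  "square f m None y = y"
| "square f m x None = x"
| "square f m (Some (i, a)) (Some (j, b)) =
     (if i = j then point i ((Suc a + Suc b) mod Suc m) else Some (f i j, (a + b) mod m))"

text \<open>The corner cell is attributed to the diagonal block \<open>(0, 0)\<close>, the only diagonal block that may be rotated.\<close>

fun label :: "(nat \<times> nat) option \<Rightarrow> (nat \<times> nat) option \<Rightarrow> nat \<times> nat" where
  "label None None = (0, 0)"
| "label None (Some (j, b)) = (j, j)"
| "label (Some (i, a)) None = (i, i)"
| "label (Some (i, a)) (Some (j, b)) = (i, j)"

text \<open>These are the symbols that a block offers for rotation. Diagonal blocks other than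
  \<open>(0, 0)\<close> offer none, and so preserve the basis vectors of their own symbols and of
  the added point.\<close>

definition block_points :: "(nat \<Rightarrow> nat \<Rightarrow> nat) \<Rightarrow> nat \<Rightarrow> nat \<times> nat \<Rightarrow> (nat \<times> nat) option set" where
  "block_points f m = (\<lambda>(i, j).
     if i \<noteq> j then Some ` ({f i j} \<times> {..<m})
     else if i = 0 then insert None (Some ` ({0} \<times> {..<m})) else {})"

text \<open>Transposing \<open>f\<close> transposes the whole square, so that facts about rows yield
  those about columns.\<close>

lemma square_commute: "square f m x y = square (\<lambda>i j. f j i) m y x"
  by (cases x; cases y) (auto simp: add.commute)

lemma label_commute: "label x y = prod.swap (label y x)"
  by (cases "(x, y)" rule: label.cases) auto

lemma add_mod_inj:
  fixes a b b' n :: nat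
  assumes "(a + b) mod n = (a + b') mod n" "b < n" "b' < n"
  shows "b = b'"
proof (rule eq_if_dvd_diff)
  have "int (a + b) mod int n = int (a + b') mod int n"
    using assms(1) by (metis of_nat_mod)
  then show "int n dvd int b - int b'" by (simp add: mod_eq_dvd_iff)
qed (fact assms)+

lemma point_inj: "point i k = point i k' \<Longrightarrow> k = k'"
  by (auto simp: point_def split: nat.splits)

text \<open>In \<open>point\<close> coordinates the row is a translation modulo
  \<open>m + 1\<close>, with no separate case for the added point.\<close>

lemma square_diag:
  assumes "a < m"
  shows "square f m (Some (i, a)) (point i k) = point i ((Suc a + k) mod Suc m)"
  using assms by (cases k) (auto simp: point_def)

lemma point_in_points: "i < t \<Longrightarrow> k < Suc m \<Longrightarrow> point i k \<in> points t m"
  by (auto simp: point_def points_def split: nat.splits)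

lemma square_range:
  assumes "idempotent_latin t f" "m > 0" "x \<in> points t m" "y \<in> points t m"
  shows "square f m x y \<in> points t m"
proof (cases x)
  case (Some p)
  then obtain i a where x: "x = Some (i, a)" "i < t" "a < m" using assms(3) by (auto simp: points_def)
  show ?thesis
  proof (cases y)
    case (Some p)
    then obtain j b where y: "y = Some (j, b)" "j < t" "b < m" using assms(4) by (auto simp: points_def)
    have "point i ((Suc a + Suc b) mod Suc m) \<in> points t m"
      using x(2) by (intro point_in_points) simp_all
    moreover have "Some (f i j, (a + b) mod m) \<in> points t m"
      using assms(1,2) x y by (simp add: points_def idempotent_latin_def)
    ultimately show ?thesis by (cases "i = j") (simp_all add: x y)
  qed (use assms x in simp)
qed (use assms in simp)

text \<open>The set \<open>D\<close>, the diagonal block with the added point, is mapped into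
  itself. All other cells give symbols of first component \<open>f i j\<close>, which differs from
  \<open>i\<close> by idempotence. The two images are disjoint, and on each part injectivity reduces
  to that of modular translation and of row \<open>i\<close> of \<open>f\<close>.\<close>

lemma square_row_inj:
  assumes f: "idempotent_latin t f" and m: "m > 0" and x: "x \<in> points t m"
  shows "inj_on (square f m x) (points t m)"
proof (cases x)
  case None
  then show ?thesis by (simp add: inj_on_def)
next
  case (Some p)
  then obtain i a where x_eq: "x = Some (i, a)" and ia: "i < t" "a < m" using x by (auto simp: points_def)
  define D where "D = point i ` {..<Suc m}"
  have off: "square f m x (Some (j, b)) = Some (f i j, (a + b) mod m)" if "j \<noteq> i" for j b
    using that by (simp add: x_eq)
  have idem: "f i j \<noteq> i" if "j < t" "j \<noteq> i" for j
    using idempotent_latin_row_eq_iff[OF f ia(1) that(1) ia(1)] idempotent_latin_diag[OF f ia(1)] that(2)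
    by simp
  have cases: "y \<in> D \<or> (\<exists>j b. y = Some (j, b) \<and> j \<noteq> i \<and> j < t \<and> b < m)" if y: "y \<in> points t m" for y
  proof (cases y)
    case None
    then have "y = point i 0" by (simp add: point_def)
    then show ?thesis by (auto simp: D_def)
  next
    case (Some p)
    then obtain j b where "y = Some (j, b)" "j < t" "b < m" using y by (auto simp: points_def)
    moreover from this have "y = point i (Suc b)" if "j = i" using that by (simp add: point_def)
    ultimately show ?thesis by (auto simp: D_def)
  qed
  have onD: "square f m x y \<in> D" if "y \<in> D" for y
    using that square_diag[OF ia(2)] by (auto simp: D_def x_eq)
  have D_fst: "z = None \<or> (\<exists>c. z = Some (i, c))" if "z \<in> D" for z
    using that by (auto simp: D_def point_def split: nat.splits)
  show ?thesis
  proof (rule inj_onI)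
    fix y y' assume y: "y \<in> points t m" and y': "y' \<in> points t m" and eq: "square f m x y = square f m x y'"
    have mixed: False if "z \<in> D" "j \<noteq> i" "j < t" "square f m x z = square f m x (Some (j, b))" for z j b
      using D_fst[OF onD[OF that(1)]] idem[OF that(3,2)] that(4) off[OF that(2)] by auto
    from cases[OF y] show "y = y'"
    proof
      assume yD: "y \<in> D"
      then have y'D: "y' \<in> D" using cases[OF y'] mixed eq by blast
      obtain k k' where k: "y = point i k" "k < Suc m" "y' = point i k'" "k' < Suc m"
        using yD y'D by (auto simp: D_def)
      have "(Suc a + k) mod Suc m = (Suc a + k') mod Suc m"
        using eq point_inj by (simp only: x_eq k square_diag[OF ia(2)])
      then show ?thesis using add_mod_inj k by metis
    next
      assume "\<exists>j b. y = Some (j, b) \<and> j \<noteq> i \<and> j < t \<and> b < m"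
      then obtain j b where j: "y = Some (j, b)" "j \<noteq> i" "j < t" "b < m" by blast
      then have "y' \<notin> D" using mixed[of y' j b] eq by auto
      then obtain j' b' where j': "y' = Some (j', b')" "j' \<noteq> i" "j' < t" "b' < m" using cases[OF y'] by blast
      have *: "f i j = f i j'" "(a + b) mod m = (a + b') mod m"
        using eq off j j' by auto
      have "j = j'" using *(1) idempotent_latin_row_eq_iff[OF f ia(1) j(3) j'(3)] by simp
      moreover have "b = b'" using *(2) j j' add_mod_inj by blast
      ultimately show ?thesis using j j' by simp
    qed
  qed
qed

text \<open>In a row of group \<open>i\<close>, copies of \<open>f i j\<close> occur only in block
  \<open>(i, j)\<close>, and the added point only in the diagonal block, so a symbol offered by a
  block determines that block. In the border row only \<open>(0, 0)\<close> offers symbols.\<close>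

lemma square_label:
  assumes f: "idempotent_latin t f" and x: "x \<in> points t m" and y: "y \<in> points t m" and y': "y' \<in> points t m"
    and mem: "square f m x y' \<in> block_points f m (label x y)"
  shows "label x y' = label x y"
proof (cases x)
  case None
  then show ?thesis using mem y y'
    by (cases y; cases y') (auto simp: block_points_def points_def split: if_splits)
next
  case (Some p)
  then obtain i a where x_eq: "x = Some (i, a)" and ia: "i < t" "a < m" using x by (auto simp: points_def)
  note inj = idempotent_latin_row_eq_iff[OF f ia(1)]
  have idem: "f i i = i" using idempotent_latin_diag[OF f ia(1)] .
  have diag: "point i k = None \<or> (\<exists>c. point i k = Some (i, c))" for k
    by (auto simp: point_def split: nat.splits)
  obtain j where j: "label x y = (i, j)" "j < t"
    using y ia by (cases y) (auto simp: x_eq points_def)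
  \<comment> \<open>The cell at \<open>y'\<close> is either diagonal, showing the added point or a
    copy of \<open>i\<close>, or off-diagonal, showing a copy of \<open>f i j'\<close>.\<close>
  have "label x y' = (i, i) \<and> (square f m x y' = None \<or> (\<exists>c. square f m x y' = Some (i, c)))
     \<or> (\<exists>j'<t. \<exists>c. j' \<noteq> i \<and> label x y' = (i, j') \<and> square f m x y' = Some (f i j', c))"
  proof (cases y')
    case (Some p)
    then obtain j' b where "y' = Some (j', b)" "j' < t" using y' by (auto simp: points_def)
    then show ?thesis using diag[of "(Suc a + Suc b) mod Suc m"] by (cases "j' = i") (simp_all add: x_eq)
  qed (simp add: x_eq)
  then show ?thesis
  proof (elim disjE exE conjE)
    assume eq: "label x y' = (i, i)" "square f m x y' = None"
    then show ?thesis using mem j by (auto simp: block_points_def split: if_splits)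
  next
    fix c assume eq: "label x y' = (i, i)" "square f m x y' = Some (i, c)"
    then show ?thesis using mem j inj[OF ia(1) j(2)] idem
      by (auto simp: block_points_def split: if_splits)
  next
    fix j' c assume eq: "j' < t" "j' \<noteq> i" "label x y' = (i, j')" "square f m x y' = Some (f i j', c)"
    then show ?thesis using mem j inj[OF eq(1) j(2)] inj[OF eq(1) ia(1)] idem
      by (auto simp: block_points_def split: if_splits)
  qed
qed

lemma block_points_swap: "block_points (\<lambda>i j. f j i) m b = block_points f m (prod.swap b)"
  by (cases b) (auto simp: block_points_def)

section \<open>Distribution of the excess and sizes of the blocks\<close>

text \<open>Greedy choice: a block of \<open>B\<close> contributes \<open>m\<close> if the remaining
  blocks cannot absorb all of \<open>x\<close>, and 0 otherwise. What is left at the end goes to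
  \<open>k0\<close>.\<close>

lemma ex_sum_sizes:
  assumes "finite B" "m \<ge> 2" "x \<noteq> 1" "x \<le> m * card B + m + 1"
  shows "\<exists>(k0::nat) k. k0 \<noteq> 1 \<and> k0 \<le> m + 1 \<and> (\<forall>b\<in>B. k b \<noteq> 1 \<and> k b \<le> m) \<and> x = k0 + sum k B"
  using assms
proof (induction B arbitrary: x rule: finite_induct)
  case empty
  then show ?case by (intro exI[of _ x]) auto
next
  case (insert b B)
  define d where "d = (if x \<le> m * card B + m + 1 then 0 else m)"
  have "d \<le> m" "d \<noteq> 1" "d \<le> x" using insert.prems by (auto simp: d_def)
  \<comment> \<open>A full block is taken only when \<open>x\<close> exceeds \<open>m + 1\<close>,
    so the remainder then exceeds 1.\<close>
  have "x - d \<noteq> 1" "x - d \<le> m * card B + m + 1"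
    using insert.prems insert.hyps by (auto simp: d_def)
  from insert.IH[OF insert.prems(1) this] obtain k0 k where k: "k0 \<noteq> 1" "k0 \<le> m + 1"
    "\<forall>b\<in>B. k b \<noteq> 1 \<and> k b \<le> m" "x - d = k0 + sum k B" by blast
  have "sum (k(b := d)) (insert b B) = d + sum k B"
    using insert.hyps by (simp add: sum.insert) (intro sum.cong, auto)
  then show ?case
    using k \<open>d \<le> m\<close> \<open>d \<noteq> 1\<close> \<open>d \<le> x\<close>
    by (intro exI[of _ k0] exI[of _ "k(b := d)"]) auto
qed

lemma card_points: "card (points t m) = m * t + 1"
proof -
  have "card (Some ` ({..<t} \<times> {..<m})) = t * m"
    by (subst card_image) (auto simp: card_cartesian_product)
  then show ?thesis by (simp add: points_def card_insert_if image_iff)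
qed

lemma finite_block_points: "finite (block_points f m b)"
  by (cases b) (simp add: block_points_def)

lemma card_block_points:
  "i \<noteq> j \<Longrightarrow> card (block_points f m (i, j)) = m"
  "card (block_points f m (0, 0)) = m + 1"
proof -
  have "card (Some ` ({i} \<times> {..<m})) = m" for i :: nat
    by (subst card_image) (auto simp: card_cartesian_product)
  then show "i \<noteq> j \<Longrightarrow> card (block_points f m (i, j)) = m" "card (block_points f m (0, 0)) = m + 1"
    by (simp_all add: block_points_def card_insert_if image_iff)
qed

lemma block_points_subset:
  assumes "idempotent_latin t f" "i < t" "j < t"
  shows "block_points f m (i, j) \<subseteq> points t m"
  using assms idempotent_latin_less[OF assms] by (auto simp: block_points_def points_def)

lemma card_off_diagonal:
  assumes "t > 0"
  shows "card {(i, j). i < t \<and> j < t \<and> i \<noteq> j} = t * (t - 1)"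
proof -
  have "{(i, j). i < t \<and> j < t \<and> i \<noteq> j} = (SIGMA i:{..<t}. {..<t} - {i})" by auto
  then show ?thesis by (simp add: card_SigmaI)
qed

section \<open>Assembly for a prescribed cardinality\<close>

theorem theorem4p5:
  fixes t m :: nat
  assumes "t \<ge> 3" and "m \<ge> 2"
  shows "\<forall>c :: nat. m * t + 1 \<le> c \<and> c \<le> m * t\<^sup>2 + 2 \<and> c \<noteq> m * t + 2 \<longrightarrow>
           (\<exists>\<Phi>. quantum_latin_square (m * t + 1) \<Phi> \<and> qls_cardinality \<Phi> = c)"
proof (intro allI impI)
  fix c assume c: "m * t + 1 \<le> c \<and> c \<le> m * t\<^sup>2 + 2 \<and> c \<noteq> m * t + 2"
  obtain f where f: "idempotent_latin t f" using ex_idempotent_latin assms(1) by blast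
  have t: "0 < t" "1 < t" using assms(1) by auto
  \<comment> \<open>Row 1 of \<open>f\<close> contains 0 in some column \<open>q\<close>, off the
    diagonal by idempotence. Block \<open>(1, q)\<close> stays unrotated and so preserves the basis
    vectors of the copies of 0, which block \<open>(0, 0)\<close> may lose.\<close>
  have "f 1 ` {..<t} = {..<t}"
    using f t by (intro inj_on_lessThan_image) (auto simp: idempotent_latin_def)
  then obtain q where q: "q < t" "f 1 q = 0" using t by (metis imageE lessThan_iff)
  have q1: "q \<noteq> 1" using idempotent_latin_diag[OF f t(2)] q(2) by auto
  define B where "B = {(i, j). i < t \<and> j < t \<and> i \<noteq> j} - {(1, q)}"
  have finB: "finite B"
    unfolding B_def by (rule finite_subset[of _ "{..<t} \<times> {..<t}"]) auto
  have "card B = t * (t - 1) - 1"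
    unfolding B_def using q q1 t by (subst card_Diff_singleton) (auto simp: card_off_diagonal)
  moreover have "t * (t - 1) \<ge> 1" using t by simp
  \<comment> \<open>The total capacity \<open>m * card B + m + 1\<close> thus equals
    \<open>m * (t * (t - 1)) + 1\<close>, the largest excess of \<open>c\<close> over
    \<open>m * t + 1\<close>; the excluded value of \<open>c\<close> is excess 1.\<close>
  ultimately have "m * card B + m = m * (t * (t - 1))"
    by (metis add.commute le_add_diff_inverse mult_Suc_right plus_1_eq_Suc)
  moreover have "m * t\<^sup>2 = m * (t * (t - 1)) + m * t"
    using t by (cases t) (simp_all add: power2_eq_square algebra_simps)
  ultimately have "c - (m * t + 1) \<le> m * card B + m + 1" "c - (m * t + 1) \<noteq> 1"
    using c by linarith+
  then obtain k0 k where k0: "k0 \<noteq> 1" "k0 \<le> m + 1" and k: "\<And>b. b \<in> B \<Longrightarrow> k b \<noteq> 1 \<and> k b \<le> m"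
    and sum: "c - (m * t + 1) = k0 + sum k B"
    using ex_sum_sizes[OF finB assms(2)] by blast
  define C where "C = insert (0, 0) B"
  \<comment> \<open>Block \<open>(0, 0)\<close> takes \<open>k0\<close>, because it alone includes
    the added point and has capacity \<open>m + 1\<close>.\<close>
  define k' where "k' = k((0, 0) := k0)"
  have zB: "(0, 0) \<notin> B" by (simp add: B_def)
  have "k' b \<le> card (block_points f m b)" if "b \<in> C" for b
    using that k[of b] k0 zB card_block_points
    by (cases "b = (0, 0)") (auto simp: C_def k'_def B_def)
  then have "\<forall>b\<in>C. \<exists>S. S \<subseteq> block_points f m b \<and> card S = k' b"
    using obtain_subset_with_card_n by metis
  then obtain S where S: "\<And>b. b \<in> C \<Longrightarrow> S b \<subseteq> block_points f m b" "\<And>b. b \<in> C \<Longrightarrow> card (S b) = k' b"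
    by metis
  define K where "K b = (if b \<in> C then S b else {})" for b
  have finC: "finite C" using finB by (simp add: C_def)
  have KC: "b \<in> C" if "K b \<noteq> {}" for b using that by (auto simp: K_def split: if_splits)
  have K_block: "K b \<subseteq> block_points f m b" for b using S(1) by (simp add: K_def)
  have finK: "finite (K b)" for b using K_block finite_block_points by (rule finite_subset)
  have C_lt: "i < t" "j < t" if "(i, j) \<in> C" for i j
    using that t by (auto simp: C_def B_def)
  have KX: "K b \<subseteq> points t m" for b
  proof (cases "b \<in> C")
    case True
    then show ?thesis using K_block[of b] block_points_subset[OF f] C_lt by (cases b) blast
  qed (simp add: K_def)
  have K1: "card (K b) \<noteq> 1" for b
    using S(2)[of b] k[of b] k0(1) by (auto simp: K_def C_def k'_def)
  have "(\<Sum>b | K b \<noteq> {}. card (K b)) = (\<Sum>b\<in>C. card (K b))"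
    using KC finC by (intro sum.mono_neutral_left) auto
  also have "\<dots> = sum k' C" using S(2) by (simp add: K_def)
  also have "\<dots> = k0 + sum k B"
    using finB zB by (auto simp: C_def k'_def intro!: sum.cong)
  finally have total: "m * t + 1 + (\<Sum>b | K b \<noteq> {}. card (K b)) = c" using sum c by linarith
  have "\<exists>\<Phi>. quantum_latin_square (m * t + 1) \<Phi> \<and>
      qls_cardinality \<Phi> = m * t + 1 + (\<Sum>b | K b \<noteq> {}. card (K b))"
  proof (rule qls_of_labelled_latin_square[where X = "points t m" and L = "square f m" and \<beta> = label])
    show "finite (points t m)" by (simp add: points_def)
    show "card (points t m) = m * t + 1" by (rule card_points)
    show "square f m x y \<in> points t m" if "x \<in> points t m" "y \<in> points t m" for x y
      using square_range[OF f _ that] assms(2) by simp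
    show "inj_on (square f m x) (points t m)" if "x \<in> points t m" for x
      using square_row_inj[OF f _ that] assms(2) by simp
    show "inj_on (\<lambda>x. square f m x y) (points t m)" if "y \<in> points t m" for y
      unfolding square_commute[of f m _ y]
      using square_row_inj[OF idempotent_latin_transpose[OF f] _ that] assms(2) by simp
    show "K b \<subseteq> points t m" "card (K b) \<noteq> 1" for b by (fact KX K1)+
    show "finite {b. K b \<noteq> {}}" by (rule finite_subset[OF _ finC]) (use KC in auto)
  next
    fix x y y' assume "x \<in> points t m" "y \<in> points t m" "y' \<in> points t m"
      and "square f m x y' \<in> K (label x y)"
    then show "label x y' = label x y"
      using square_label[OF f] K_block by blast
  next
    fix x x' y assume xy: "x \<in> points t m" "x' \<in> points t m" "y \<in> points t m"
      and "square f m x' y \<in> K (label x y)"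
    then have "square f m x' y \<in> block_points f m (label x y)"
      using K_block by blast
    \<comment> \<open>The column condition is the row condition for the transposed
      \<open>f\<close>.\<close>
    then have "square (\<lambda>i j. f j i) m y x' \<in> block_points (\<lambda>i j. f j i) m (label y x)"
      by (simp only: square_commute[of f m x' y] label_commute[of x y] block_points_swap[of f])
    from square_label[OF idempotent_latin_transpose[OF f] xy(3,1,2) this]
    show "label x' y = label x y" by (simp add: label_commute[of _ y])
  next
    fix b assume "K b \<noteq> {}"
    then have b: "b \<in> C" by (rule KC)
    obtain i j where ij: "b = (i, j)" by (cases b)
    have "i < t" "j < t" using C_lt b ij by blast+
    then have "Some (i, 0) \<in> points t m" "Some (j, 0) \<in> points t m"
      using assms(2) by (auto simp: points_def)
    then show "\<exists>x\<in>points t m. \<exists>y\<in>points t m. label x y = b"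
      unfolding ij by (metis label.simps(4))
  next
    fix s assume s: "s \<in> points t m"
    \<comment> \<open>Each basis vector is located in an unrotated block: the added point in
      \<open>(1, 1)\<close>, copies of 0 in \<open>(1, q)\<close>, and copies of
      \<open>i > 0\<close> in the border row, labelled \<open>(i, i)\<close>.\<close>
    consider "s = None" | a where "s = Some (0, a)" "a < m" | i a where "s = Some (i, a)" "0 < i" "i < t" "a < m"
      using s by (auto simp: points_def)
    then show "\<exists>x\<in>points t m. \<exists>y\<in>points t m. square f m x y = s \<and> s \<notin> K (label x y)"
    proof cases
      case 1
      have "K (1, 1) = {}" by (simp add: K_def C_def B_def)
      \<comment> \<open>The residues are 1 and \<open>m\<close>, with sum 0 modulo
        \<open>m + 1\<close>.\<close>
      moreover have "square f m (Some (1, 0)) (Some (1, m - 1)) = None"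
        using assms(2) by (simp add: point_def)
      moreover have "Some (1, 0) \<in> points t m" "Some (1, m - 1) \<in> points t m"
        using assms t by (auto simp: points_def)
      ultimately show ?thesis using 1 by (metis empty_iff label.simps(4))
    next
      case (2 a)
      have "K (1, q) = {}" by (simp add: K_def C_def B_def)
      moreover have "square f m (Some (1, 0)) (Some (q, a)) = s"
        using 2 q q1 by simp
      moreover have "Some (1, 0) \<in> points t m" "Some (q, a) \<in> points t m"
        using assms t q 2 by (auto simp: points_def)
      ultimately show ?thesis by (metis empty_iff label.simps(4))
    next
      case (3 i a)
      then have "K (i, i) = {}" by (simp add: K_def C_def B_def)
      moreover have "None \<in> points t m" by (simp add: points_def)
      ultimately show ?thesis using s 3(1) by (intro bexI[of _ None] bexI[of _ s]) auto
    qed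
  qed
  then show "\<exists>\<Phi>. quantum_latin_square (m * t + 1) \<Phi> \<and> qls_cardinality \<Phi> = c"
    unfolding total .
qed

end
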